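(* Let $n \in \mathbb{N}$. On finite $n$-dimensional signed barcodes: (1) for any pair of finite signed barcodes $\mathcal{B}$ and $\mathcal{C}$, we have $\widehat{d_{W^1}}(\mathcal{B},\mathcal{C}) = 0$ if and only if $\overline{\mathcal{B}}=\overline{\mathcal{C}}$; (2) the dissimilarity $\widehat{d_{W^1}}$ satisfies the triangle inequality; (3) for any pair of finite signed barcodes $\mathcal{B}$ and $\mathcal{C}$, we have $\widehat{d_{W^1}}(\mathcal{B},\mathcal{C}) = \widehat{d_{W^1}}(\overline{\mathcal{B}},\overline{\mathcal{C}})$.
   Context: An $n$-dimensional barcode is a multiset of elements of $\mathbb{R}^n$; a signed barcode is an ordered pair $\mathcal{B}=(\mathcal{B}_+,\mathcal{B}_-)$ of barcodes. Multisets are considered up to isomorphism (equality means equal multiplicities); $\cup$ is disjoint union of multisets (multiplicities add). For finite barcodes, $d_{W^1}(\mathcal{B},\mathcal{C}) \in [0,\infty]$ is the infimum of $\sum_{i \in \mathcal{B}} \|i - h(i)\|_1$ over all bijections of multisets $h : \mathcal{B} \to \mathcal{C}$ ($\infty$ if there is none). For finite signed barcodes, $\widehat{d_{W^1}}(\mathcal{B},\mathcal{C}) = d_{W^1}(\mathcal{B}_+\cup\mathcal{C}_-,\ \mathcal{C}_+\cup\mathcal{B}_-)$. For a finite signed barcode $\mathcal{B}=(\mathcal{B}_+,\mathcal{B}_-)$, $\overline{\mathcal{B}}=(\overline{\mathcal{B}}_+,\overline{\mathcal{B}}_-)$ denotes the signed barcode obtained by cancelling, with multiplicity, the elements common to $\mathcal{B}_+$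 and $\mathcal{B}_-$ (so $\overline{\mathcal{B}}_+$ and $\overline{\mathcal{B}}_-$ are disjoint). *)

theory Defs
  imports "HOL-Analysis.Analysis" "HOL-Library.Multiset"
begin

text \<open>
  Points of $n$-space are the functions \<^typ>\<open>nat \<Rightarrow> real\<close> in
  \<^term>\<open>topspace (Euclidean_space n)\<close>, i.e. those vanishing at all indices \<open>i \<ge> n\<close>;
  this allows every \<open>n :: nat\<close>, including \<open>n = 0\<close>.
  The type \<open>'a multiset\<close> contains only finite multisets, so all barcodes below are finite.
\<close>

type_synonym barcode = "(nat \<Rightarrow> real) multiset"
type_synonym signed_barcode = "barcode \<times> barcode"

definition barcodes :: "nat \<Rightarrow> barcode set" where
  "barcodes n = {B. set_mset B \<subseteq> topspace (Euclidean_space n)}"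

definition signed_barcodes :: "nat \<Rightarrow> signed_barcode set" where
  "signed_barcodes n = barcodes n \<times> barcodes n"

definition l1_norm :: "nat \<Rightarrow> (nat \<Rightarrow> real) \<Rightarrow> real" where
  "l1_norm n x = (\<Sum>k<n. \<bar>x k\<bar>)"

text \<open>
  An element of multiplicity \<open>m\<close> has the \<open>m\<close> distinct instances \<open>(x, 0), \<dots>, (x, m - 1)\<close>.
  A bijection of multisets is a bijection between the sets of instances.
\<close>

definition instances :: "'a multiset \<Rightarrow> ('a \<times> nat) set" where
  "instances B = (SIGMA x:set_mset B. {..<count B x})"

definition matching_cost ::
    "nat \<Rightarrow> barcode \<Rightarrow> ((nat \<Rightarrow> real) \<times> nat \<Rightarrow> (nat \<Rightarrow> real) \<times> nat) \<Rightarrow> real" where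
  "matching_cost n B h = (\<Sum>i\<in>instances B. l1_norm n (\<lambda>k. fst i k - fst (h i) k))"

text \<open>The infimum over the empty set is \<open>\<infinity>\<close> in \<^typ>\<open>ennreal\<close>.\<close>

definition dW1 :: "nat \<Rightarrow> barcode \<Rightarrow> barcode \<Rightarrow> ennreal" where
  "dW1 n B C =
     (INF h \<in> {h. bij_betw h (instances B) (instances C)}. ennreal (matching_cost n B h))"

definition signed_dW1 :: "nat \<Rightarrow> signed_barcode \<Rightarrow> signed_barcode \<Rightarrow> ennreal" where
  "signed_dW1 n B C = dW1 n (fst B + snd C) (fst C + snd B)"

definition cancel :: "signed_barcode \<Rightarrow> signed_barcode" where
  "cancel B = (fst B - (fst B \<inter># snd B), snd B - (fst B \<inter># snd B))"

end

theory Submission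
  imports Defs
begin

text \<open>
  Up to the labelling of instances, a bijection of multisets \<open>B \<rightarrow> C\<close> is a multiset \<open>M\<close> of
  pairs whose two projections are \<open>B\<close> and \<open>C\<close>, and its cost is the sum of the distances over the
  pairs in \<open>M\<close>. So \<^const>\<open>dW1\<close> is an infimum over such pairings (\<open>dW1_eq_INF_pairing\<close>), which
  can be added and modified pair by pair.

  The whole result rests on one operation, \<open>pairing_cancel\<close>: a pairing of \<open>B + A\<close> with \<open>C + A\<close>
  can be turned into a pairing of \<open>B\<close> with \<open>C\<close> that costs no more. For a single common point
  \<open>z\<close>, either \<open>z\<close> is paired with itself and that pair is dropped, or there are pairs \<open>(x, z)\<close> and
  \<open>(z, y)\<close>, which the triangle inequality allows to be replaced by the shortcut \<open>(x, y)\<close>.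
  Conversely, pairing each point of \<open>A\<close> with itself is free, so \<^const>\<open>dW1\<close> is invariant
  under adding a common summand (\<open>dW1_add_cancel\<close>).

  Invariance under cancellation of a signed barcode is an instance of this. The triangle inequality
  uses it too: the sum of a pairing for \<open>(B, C)\<close> and one for \<open>(C, D)\<close> is a pairing for
  \<open>(B, D)\<close> with the common summand \<open>C\<^sub>+ + C\<^sub>-\<close> on both sides, which can be cancelled. Finally, \<^const>\<open>dW1\<close> vanishes
  only on equal barcodes, because the positive distances between two finite sets of points are
  bounded away from \<open>0\<close>, and \<open>B\<^sub>+ + C\<^sub>- = C\<^sub>+ + B\<^sub>-\<close> says exactly that the cancelled signed barcodes agree.
\<close>

section \<open>Bijections of instances as pairings\<close>

definition pairing :: "('a \<times> 'b) multiset \<Rightarrow> 'a multiset \<Rightarrow> 'b multiset \<Rightarrow> bool" where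
  "pairing M B C \<longleftrightarrow> image_mset fst M = B \<and> image_mset snd M = C"

definition pairing_cost :: "('a \<Rightarrow> 'b \<Rightarrow> real) \<Rightarrow> ('a \<times> 'b) multiset \<Rightarrow> real" where
  "pairing_cost d M = (\<Sum>(x, y)\<in>#M. d x y)"

definition l1_dist :: "nat \<Rightarrow> (nat \<Rightarrow> real) \<Rightarrow> (nat \<Rightarrow> real) \<Rightarrow> real" where
  "l1_dist n x y = l1_norm n (\<lambda>k. x k - y k)"

lemma finite_instances [simp]: "finite (instances B)"
  by (simp add: instances_def)

lemma image_mset_fst_instances: "image_mset fst (mset_set (instances B)) = B"
proof (rule multiset_eqI)
  fix x
  have "count (image_mset fst (mset_set (instances B))) x = card (fst -` {x} \<inter> instances B)"
    by (simp add: count_image_mset)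
  also have "fst -` {x} \<inter> instances B = {x} \<times> {..<count B x}"
    by (auto simp: instances_def simp flip: count_greater_zero_iff)
  finally show "count (image_mset fst (mset_set (instances B))) x = count B x"
    by (simp add: card_cartesian_product)
qed

text \<open>
  Each fibre of \<open>f\<close> has as many elements as its value has instances, so numbering the
  fibres lifts \<open>f\<close> to the instances.
\<close>

lemma labelling_exists:
  assumes "finite I" "image_mset f (mset_set I) = B"
  obtains g where "bij_betw g I (instances B)" "\<And>i. i \<in> I \<Longrightarrow> fst (g i) = f i"
proof -
  have card: "card {i\<in>I. f i = x} = count B x" for x
  proof -
    have "{i\<in>I. f i = x} = f -` {x} \<inter> I" by auto
    then show ?thesis using assms by (auto simp: count_image_mset)
  qed
  have "\<exists>e. bij_betw e {i\<in>I. f i = x} {..<count B x}" for x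
    using assms(1) by (intro finite_same_card_bij) (auto simp: card)
  then obtain e where e: "\<And>x. bij_betw (e x) {i\<in>I. f i = x} {..<count B x}"
    by metis
  have set_B: "set_mset B = f ` I"
    using assms by auto
  have "bij_betw (\<lambda>i. (f i, e (f i) i)) I (instances B)"
    unfolding bij_betw_def
  proof (intro conjI inj_onI set_eqI iffI)
    fix i j assume "i \<in> I" "j \<in> I" "(f i, e (f i) i) = (f j, e (f j) j)"
    then show "i = j"
      using bij_betw_imp_inj_on[OF e[of "f i"]] by (auto dest: inj_onD)
  next
    fix p assume "p \<in> (\<lambda>i. (f i, e (f i) i)) ` I"
    then show "p \<in> instances B"
      using bij_betwE[OF e] by (fastforce simp: instances_def set_B)
  next
    fix p assume "p \<in> instances B"
    then have "snd p \<in> {..<count B (fst p)}"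
      by (auto simp: instances_def)
    then have "snd p \<in> e (fst p) ` {i\<in>I. f i = fst p}"
      using bij_betw_imp_surj_on[OF e[of "fst p"]] by simp
    then obtain i where "i \<in> I" "f i = fst p" "e (fst p) i = snd p"
      by auto
    then show "p \<in> (\<lambda>i. (f i, e (f i) i)) ` I"
      by (intro image_eqI[of _ _ i]) auto
  qed
  then show thesis
    by (rule that) simp
qed

lemma matching_cost_eq_pairing_cost:
  "matching_cost n B h =
     pairing_cost (l1_dist n) (image_mset (\<lambda>i. (fst i, fst (h i))) (mset_set (instances B)))"
  by (simp add: matching_cost_def pairing_cost_def l1_dist_def image_mset.compositionality
      o_def sum_unfold_sum_mset)

lemma pairing_of_bijection:
  assumes "bij_betw h (instances B) (instances C)"
  shows "pairing (image_mset (\<lambda>i. (fst i, fst (h i))) (mset_set (instances B))) B C"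
proof -
  have "image_mset h (mset_set (instances B)) = mset_set (instances C)"
    using assms by (simp add: bij_betw_def image_mset_mset_set)
  then have "image_mset (fst \<circ> h) (mset_set (instances B)) = C"
    by (metis image_mset.compositionality image_mset_fst_instances)
  then show ?thesis
    by (simp add: pairing_def image_mset.compositionality o_def image_mset_fst_instances)
qed

text \<open>
  Labelling the instances of \<open>M\<close> by the instances of both its projections gives two
  bijections, and the required one leads from the first set of labels to the second.
\<close>

lemma bijection_of_pairing:
  assumes "pairing M B C"
  obtains h where "bij_betw h (instances B) (instances C)"
    "image_mset (\<lambda>i. (fst i, fst (h i))) (mset_set (instances B)) = M"
proof -
  have "image_mset (fst \<circ> fst) (mset_set (instances M)) = B"
    "image_mset (snd \<circ> fst) (mset_set (instances M)) = C"
    using assms image_mset_fst_instances[of M]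
    by (metis image_mset.compositionality pairing_def)+
  then obtain b c where
    b: "bij_betw b (instances M) (instances B)" "\<And>i. i \<in> instances M \<Longrightarrow> fst (b i) = fst (fst i)" and
    c: "bij_betw c (instances M) (instances C)" "\<And>i. i \<in> instances M \<Longrightarrow> fst (c i) = snd (fst i)"
    using labelling_exists[OF finite_instances] by (metis comp_apply)
  define h where "h = c \<circ> inv_into (instances M) b"
  have h_b: "h (b i) = c i" if "i \<in> instances M" for i
    using b(1) that by (simp add: h_def bij_betw_def)
  have "mset_set (instances B) = image_mset b (mset_set (instances M))"
    using b(1) by (simp add: bij_betw_def image_mset_mset_set)
  then have "image_mset (\<lambda>i. (fst i, fst (h i))) (mset_set (instances B))
      = image_mset (\<lambda>i. (fst (b i), fst (h (b i)))) (mset_set (instances M))"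
    by (simp add: image_mset.compositionality o_def)
  also have "\<dots> = image_mset fst (mset_set (instances M))"
    by (rule image_mset_cong) (simp add: h_b b c)
  finally have "image_mset (\<lambda>i. (fst i, fst (h i))) (mset_set (instances B)) = M"
    by (simp add: image_mset_fst_instances)
  moreover have "bij_betw h (instances B) (instances C)"
    unfolding h_def using b(1) c(1) by (blast intro: bij_betw_trans bij_betw_inv_into)
  ultimately show thesis
    using that by blast
qed

lemma dW1_eq_INF_pairing:
  "dW1 n B C = (INF M \<in> {M. pairing M B C}. ennreal (pairing_cost (l1_dist n) M))"
proof -
  let ?M = "\<lambda>h. image_mset (\<lambda>i. (fst i, fst (h i))) (mset_set (instances B))"
  have "{M. pairing M B C} = ?M ` {h. bij_betw h (instances B) (instances C)}"
    using pairing_of_bijection by (auto elim!: bijection_of_pairing)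
  then show ?thesis
    by (simp add: dW1_def matching_cost_eq_pairing_cost image_image)
qed

lemma dW1_le_pairing_cost: "pairing M B C \<Longrightarrow> dW1 n B C \<le> ennreal (pairing_cost (l1_dist n) M)"
  unfolding dW1_eq_INF_pairing by (rule INF_lower) simp

section \<open>Cancelling common points\<close>

lemma pairing_cost_add_mset [simp]:
  "pairing_cost d (add_mset (x, y) M) = d x y + pairing_cost d M"
  by (simp add: pairing_cost_def)

lemma pairing_cost_add: "pairing_cost d (M + N) = pairing_cost d M + pairing_cost d N"
  by (simp add: pairing_cost_def)

lemma pairing_add: "pairing M B C \<Longrightarrow> pairing N B' C' \<Longrightarrow> pairing (M + N) (B + B') (C + C')"
  by (auto simp: pairing_def)

lemma pairing_cost_nonneg: "(\<And>x y. 0 \<le> d x y) \<Longrightarrow> 0 \<le> pairing_cost d M"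
  by (induction M) (auto simp: pairing_cost_def)

lemma pairing_diagonal: "pairing (image_mset (\<lambda>z. (z, z)) A) A A"
  by (simp add: pairing_def image_mset.compositionality o_def)

lemma pairing_cost_diagonal:
  "(\<And>z. d z z = 0) \<Longrightarrow> pairing_cost d (image_mset (\<lambda>z. (z, z)) A) = 0"
  by (induction A) (auto simp: pairing_cost_def)

text \<open>
  If \<open>z\<close> is not paired with itself, then the pair with first entry \<open>z\<close> and the pair with second
  entry \<open>z\<close> are different members of \<open>M\<close>, so both can be removed at once and bridged by a single
  pair.
\<close>

lemma pairing_cancel_point:
  assumes nonneg: "\<And>x y. 0 \<le> d x y" and triangle: "\<And>x y z. d x y \<le> d x z + d z y"
    and M: "pairing M (add_mset z B) (add_mset z C)"
  obtains N where "pairing N B C" "pairing_cost d N \<le> pairing_cost d M"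
proof (cases "(z, z) \<in># M")
  case True
  then obtain N where "M = add_mset (z, z) N"
    by (blast dest: multi_member_split)
  then show thesis
    using that[of N] M nonneg[of z z] by (simp add: pairing_def)
next
  case False
  have "z \<in># image_mset fst M" "z \<in># image_mset snd M"
    using M by (simp_all add: pairing_def)
  then obtain x y where xy: "(z, y) \<in># M" "(x, z) \<in># M"
    by force
  then obtain K where K: "M = add_mset (z, y) K"
    by (blast dest: multi_member_split)
  moreover have "(x, z) \<in># K"
    using xy False K by auto
  then obtain L where "K = add_mset (x, z) L"
    by (blast dest: multi_member_split)
  ultimately have "M = add_mset (z, y) (add_mset (x, z) L)"
    by simp
  then show thesis
    using that[of "add_mset (x, y) L"] M triangle[of x y z] by (auto simp: pairing_def)
qed

lemma pairing_cancel:
  assumes nonneg: "\<And>x y. 0 \<le> d x y" and triangle: "\<And>x y z. d x y \<le> d x z + d z y"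
    and "pairing M (B + A) (C + A)"
  shows "\<exists>N. pairing N B C \<and> pairing_cost d N \<le> pairing_cost d M"
  using assms(3)
proof (induction A arbitrary: M)
  case empty
  then show ?case by auto
next
  case (add z A)
  then have "pairing M (add_mset z (B + A)) (add_mset z (C + A))"
    by simp
  then obtain N where "pairing N (B + A) (C + A)" "pairing_cost d N \<le> pairing_cost d M"
    by (rule pairing_cancel_point[OF nonneg triangle])
  then show ?case
    using add.IH by (meson order_trans)
qed

lemma l1_dist_nonneg: "0 \<le> l1_dist n x y"
  by (simp add: l1_dist_def l1_norm_def sum_nonneg)

lemma l1_dist_self: "l1_dist n x x = 0"
  by (simp add: l1_dist_def l1_norm_def)

lemma l1_dist_triangle: "l1_dist n x y \<le> l1_dist n x z + l1_dist n z y"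
  unfolding l1_dist_def l1_norm_def sum.distrib[symmetric] by (rule sum_mono) linarith

text \<open>
  Nearly optimal pairings for the two summands add up to a pairing for the sum; the slack \<open>e\<close> is
  split evenly between them.
\<close>

lemma dW1_add_le: "dW1 n (B + B') (C + C') \<le> dW1 n B C + dW1 n B' C'"
proof (rule ennreal_le_epsilon)
  fix e :: real
  assume fin: "dW1 n B C + dW1 n B' C' < top" and "0 < e"
  have near: "\<exists>M. pairing M X Y \<and> ennreal (pairing_cost (l1_dist n) M) < dW1 n X Y + ennreal (e / 2)"
    if "dW1 n X Y < top" for X Y
  proof -
    have "dW1 n X Y < dW1 n X Y + ennreal (e / 2)"
      using that \<open>0 < e\<close> by (simp add: ennreal_add_left_cancel_less)
    then show ?thesis
      by (subst (asm) (1) dW1_eq_INF_pairing) (auto simp: INF_less_iff)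
  qed
  obtain M where M: "pairing M B C"
    "ennreal (pairing_cost (l1_dist n) M) < dW1 n B C + ennreal (e / 2)"
    using near[of B C] fin by (auto simp: ennreal_add_less_top)
  obtain N where N: "pairing N B' C'"
    "ennreal (pairing_cost (l1_dist n) N) < dW1 n B' C' + ennreal (e / 2)"
    using near[of B' C'] fin by (auto simp: ennreal_add_less_top)
  have "dW1 n (B + B') (C + C')
      \<le> ennreal (pairing_cost (l1_dist n) M) + ennreal (pairing_cost (l1_dist n) N)"
    using dW1_le_pairing_cost[OF pairing_add[OF M(1) N(1)], of n]
    by (simp add: pairing_cost_add pairing_cost_nonneg l1_dist_nonneg)
  also have "\<dots> \<le> (dW1 n B C + ennreal (e / 2)) + (dW1 n B' C' + ennreal (e / 2))"
    using M(2) N(2) by (intro add_mono) auto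
  also have "\<dots> = dW1 n B C + dW1 n B' C' + (ennreal (e / 2) + ennreal (e / 2))"
    by (simp only: ac_simps)
  also have "ennreal (e / 2) + ennreal (e / 2) = ennreal e"
    using \<open>0 < e\<close> by (simp flip: ennreal_plus)
  finally show "dW1 n (B + B') (C + C') \<le> dW1 n B C + dW1 n B' C' + ennreal e" .
qed

lemma dW1_add_cancel: "dW1 n (B + A) (C + A) = dW1 n B C"
proof (rule antisym)
  have "dW1 n A A = 0"
    using dW1_le_pairing_cost[OF pairing_diagonal, of n A]
    by (simp add: pairing_cost_diagonal l1_dist_self)
  then show "dW1 n (B + A) (C + A) \<le> dW1 n B C"
    using dW1_add_le[of n B A C A] by simp
next
  show "dW1 n B C \<le> dW1 n (B + A) (C + A)"
    unfolding dW1_eq_INF_pairing[of n "B + A"]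
  proof (rule INF_greatest)
    fix M assume "M \<in> {M. pairing M (B + A) (C + A)}"
    then obtain N where "pairing N B C" "pairing_cost (l1_dist n) N \<le> pairing_cost (l1_dist n) M"
      using pairing_cancel[of "l1_dist n"] l1_dist_nonneg l1_dist_triangle by blast
    then show "dW1 n B C \<le> ennreal (pairing_cost (l1_dist n) M)"
      using dW1_le_pairing_cost ennreal_leI order_trans by blast
  qed
qed

section \<open>Barcodes at distance zero\<close>

lemma l1_dist_eq_0_iff:
  assumes "x \<in> topspace (Euclidean_space n)" "y \<in> topspace (Euclidean_space n)"
  shows "l1_dist n x y = 0 \<longleftrightarrow> x = y"
proof
  assume "l1_dist n x y = 0"
  then have "x k = y k" if "k < n" for k
    using that by (simp add: l1_dist_def l1_norm_def sum_nonneg_eq_0_iff)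
  moreover have "x k = y k" if "k \<ge> n" for k
    using assms that by (simp add: topspace_Euclidean_space)
  ultimately show "x = y"
    by (meson ext not_le)
qed (simp add: l1_dist_self)

lemma pairing_cost_ge_member:
  assumes "\<And>x y. 0 \<le> d x y" "(x, y) \<in># M"
  shows "d x y \<le> pairing_cost d M"
  using assms pairing_cost_nonneg[of d] by (force dest: multi_member_split)

lemma dW1_eq_0_iff:
  assumes "B \<in> barcodes n" "C \<in> barcodes n"
  shows "dW1 n B C = 0 \<longleftrightarrow> B = C"
proof
  assume "dW1 n B C = 0"
  let ?D = "(\<lambda>(x, y). l1_dist n x y) ` (set_mset B \<times> set_mset C) - {0}"
  \<comment> \<open>A positive lower bound for all nonzero distances; the \<open>1\<close> covers the case that
    there are none.\<close>
  define \<epsilon> where "\<epsilon> = Min (insert 1 ?D)"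
  have "0 < \<epsilon>"
    unfolding \<epsilon>_def using l1_dist_nonneg[of n] by (subst Min_gr_iff) (auto simp: less_le)
  with \<open>dW1 n B C = 0\<close> have "(INF M \<in> {M. pairing M B C}. ennreal (pairing_cost (l1_dist n) M)) < ennreal \<epsilon>"
    by (simp add: dW1_eq_INF_pairing)
  then obtain M where M: "pairing M B C" "pairing_cost (l1_dist n) M < \<epsilon>"
    by (auto simp: INF_less_iff ennreal_less_iff pairing_cost_nonneg l1_dist_nonneg)
  have "fst p = snd p" if "p \<in># M" for p
  proof -
    obtain x y where p: "p = (x, y)" by force
    have xy: "x \<in># B" "y \<in># C"
      using M(1) that p by (force simp: pairing_def)+
    have "l1_dist n x y < \<epsilon>"
      using pairing_cost_ge_member[of "l1_dist n" x y M] M(2) that p l1_dist_nonneg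
      by (meson order_le_less_trans)
    moreover have "\<epsilon> \<le> l1_dist n x y" if "l1_dist n x y \<noteq> 0"
      unfolding \<epsilon>_def using xy that by (intro Min_le) force+
    ultimately have "l1_dist n x y = 0"
      by force
    then show ?thesis
      using l1_dist_eq_0_iff[of x n y] xy assms p by (auto simp: barcodes_def)
  qed
  then have "image_mset fst M = image_mset snd M"
    by (rule image_mset_cong)
  then show "B = C"
    using M(1) unfolding pairing_def by metis
next
  assume "B = C"
  then show "dW1 n B C = 0"
    using dW1_le_pairing_cost[OF pairing_diagonal, of n B]
    by (simp add: pairing_cost_diagonal l1_dist_self)
qed

section \<open>Signed barcodes\<close>

lemma cancel_eq_iff: "cancel B = cancel C \<longleftrightarrow> fst B + snd C = fst C + snd B"
proof -
  \<comment> \<open>Multiplicity by multiplicity: \<open>a - b = c - d\<close> in the integers iff the positive and the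
    negative parts of both sides agree; truncated subtraction gives the positive part.\<close>
  have "a - b = c - d \<and> b - a = d - c \<longleftrightarrow> a + d = c + b" for a b c d :: nat
    by linarith
  then show ?thesis
    by (simp add: cancel_def multiset_eq_iff flip: all_conj_distrib)
qed

lemma signed_dW1_eq_0_iff:
  assumes "B \<in> signed_barcodes n" "C \<in> signed_barcodes n"
  shows "signed_dW1 n B C = 0 \<longleftrightarrow> cancel B = cancel C"
proof -
  have "fst B + snd C \<in> barcodes n" "fst C + snd B \<in> barcodes n"
    using assms by (auto simp: signed_barcodes_def barcodes_def)
  then show ?thesis
    by (simp add: signed_dW1_def dW1_eq_0_iff cancel_eq_iff)
qed

lemma signed_dW1_triangle: "signed_dW1 n B D \<le> signed_dW1 n B C + signed_dW1 n C D"
proof -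
  have "signed_dW1 n B D
      = dW1 n ((fst B + snd D) + (fst C + snd C)) ((fst D + snd B) + (fst C + snd C))"
    by (simp add: signed_dW1_def dW1_add_cancel)
  also have "\<dots> = dW1 n ((fst B + snd C) + (fst C + snd D)) ((fst C + snd B) + (fst D + snd C))"
    by (simp add: ac_simps)
  also have "\<dots> \<le> signed_dW1 n B C + signed_dW1 n C D"
    unfolding signed_dW1_def by (rule dW1_add_le)
  finally show ?thesis .
qed

lemma signed_dW1_cancel: "signed_dW1 n (cancel B) (cancel C) = signed_dW1 n B C"
proof -
  let ?A = "(fst B \<inter># snd B) + (fst C \<inter># snd C)"
  have "fst B + snd C = (fst (cancel B) + snd (cancel C)) + ?A"
    "fst C + snd B = (fst (cancel C) + snd (cancel B)) + ?A"
    by (auto simp: cancel_def intro!: multiset_eqI)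
  then show ?thesis
    by (simp only: signed_dW1_def dW1_add_cancel)
qed

theorem proposition6p2:
  fixes n :: nat
  shows "(\<forall>B\<in>signed_barcodes n. \<forall>C\<in>signed_barcodes n.
            signed_dW1 n B C = 0 \<longleftrightarrow> cancel B = cancel C) \<and>
         (\<forall>B\<in>signed_barcodes n. \<forall>C\<in>signed_barcodes n. \<forall>D\<in>signed_barcodes n.
            signed_dW1 n B D \<le> signed_dW1 n B C + signed_dW1 n C D) \<and>
         (\<forall>B\<in>signed_barcodes n. \<forall>C\<in>signed_barcodes n.
            signed_dW1 n B C = signed_dW1 n (cancel B) (cancel C))"
  by (simp add: signed_dW1_eq_0_iff signed_dW1_triangle signed_dW1_cancel)

end
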